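(* Let $T,d_w\ge1$ be integers and let $w_1,\dots,w_T\in\mathbb{R}^{d_w}$ be fixed known vectors such that, for every $t\in\{1,\dots,T\}$, $w_{t,k}\in\{0,1\}$ for all $k\in\{1,\dots,d_w\}$ and $\sum_{k=1}^{d_w}w_{t,k}=1$. Let $Y=(Y_1,\dots,Y_T)'$ be a random vector in $\{0,1\}^T$, $Y_0\in\{0,1\}$ an initial condition, $A$ an unobserved random vector in $\mathbb{R}^{d_w}$ and $\gamma\in\mathbb{R}$ a parameter such that, for all $y\in\{0,1\}^T$, $$\Pr(Y=y\mid Y_0=y_0,A)=\prod_{t=1}^T\left[\frac{1}{1+\exp(y_{t-1}\gamma+w_t'A)}\right]^{1-y_t}\left[\frac{\exp(y_{t-1}\gamma+w_t'A)}{1+\exp(y_{t-1}\gamma+w_t'A)}\right]^{y_t}.$$ The initial condition $Y_0=y_0$ is treated as fixed and known. Put $\mathsf{W}=(w_1,\dots,w_T)\in\mathbb{R}^{d_w\times T}$, $\mathsf{W}_{\rm lead}=(w_2,w_3,\dots,w_T,0_{d_w\times1})\in\mathbb{R}^{d_w\times T}$, $\mathsf{V}=(\mathsf{W}',\mathsf{W}_{\rm lead}')'\in\mathbb{R}^{2d_w\times T}$, and $Y_{\rm lag}=(Y_0,Y_1,\dots,Y_{T-1})'$. Then: (i) $(\mathsf{W}Y,\mathsf{W}Y_{\rm lag})$ is a sufficient statistic for $A$ conditional on $Y_0$, in the sense that the conditional distribution of $Y$ given $(\mathsf{W}Y,\mathsf{W}Y_{\rm lag})$, $Y_0=y_0$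 and $A$ does not depend on $A$. Since $Y_0=y_0$ is fixed, this sufficient statistic can equivalently be expressed as the linear transformation $\mathsf{V}Y$ (that is, each of $(\mathsf{W}Y,\mathsf{W}Y_{\rm lag})$ and $\mathsf{V}Y$ is a function of the other given $y_0$). (ii) Suppose further that there exist $y,\tilde y\in\{0,1\}^T$ such that $\mathsf{V}y=\mathsf{V}\tilde y$ and $\sum_{t=1}^T y_ty_{t-1}\ne\sum_{t=1}^T\tilde y_t\tilde y_{t-1}$, where $\tilde y_0=y_0$ (both equal to the given initial condition). Then the autoregressive parameter $\gamma$ is uniquely identified from the distribution of $Y$ conditional on $Y_0=y_0$.
   Context: No restriction is placed on the distribution of $A$ given $Y_0=y_0$ (other than being a probability distribution on $\mathbb{R}^{d_w}$). "$\gamma$ is uniquely identified from the distribution of $Y$ conditional on $Y_0=y_0$" means: if two values $\gamma,\tilde\gamma\in\mathbb{R}$, each combined with some distribution of $A$ given $Y_0=y_0$, generate through the model the same distribution of $Y$ given $Y_0=y_0$, then $\gamma=\tilde\gamma$. The prime denotes transpose. *)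

theory Defs
  imports "HOL-Probability.Probability"
begin

definition outcomes :: "nat \<Rightarrow> (nat \<Rightarrow> nat) set" where
  "outcomes T = ({1..T} \<rightarrow>\<^sub>E {0, 1})"

text \<open>\<open>lag y0 y t\<close> is \<open>y\<^sub>t\<^sub>-\<^sub>1\<close>, with the initial condition in position \<open>0\<close>;
  it is only used for \<open>t \<ge> 1\<close>.\<close>

definition lag :: "nat \<Rightarrow> (nat \<Rightarrow> nat) \<Rightarrow> nat \<Rightarrow> nat" where
  "lag y0 y t = (y(0 := y0)) (t - 1)"

text \<open>A matrix with \<open>T\<close> columns is represented by the family of its columns, indexed by
  \<open>1, \<dots>, T\<close>, so that \<open>mat_app T c x\<close> is the matrix-vector product.\<close>

definition mat_app :: "nat \<Rightarrow> (nat \<Rightarrow> real ^ 'n) \<Rightarrow> (nat \<Rightarrow> nat) \<Rightarrow> real ^ 'n" where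
  "mat_app T c x = (\<Sum>t = 1..T. real (x t) *\<^sub>R c t)"

definition W_lead :: "nat \<Rightarrow> (nat \<Rightarrow> real ^ 'd) \<Rightarrow> nat \<Rightarrow> real ^ 'd" where
  "W_lead T w t = (if t < T then w (t + 1) else 0)"

text \<open>Stacking two blocks of \<open>'d\<close> rows gives a matrix with rows indexed by \<open>'d + 'd\<close>.\<close>

definition V_mat :: "nat \<Rightarrow> (nat \<Rightarrow> real ^ 'd) \<Rightarrow> nat \<Rightarrow> real ^ ('d + 'd)" where
  "V_mat T w t = (\<chi> i. case i of Inl k \<Rightarrow> w t $ k | Inr k \<Rightarrow> W_lead T w t $ k)"

definition suff_stat ::
  "nat \<Rightarrow> (nat \<Rightarrow> real ^ 'd) \<Rightarrow> nat \<Rightarrow> (nat \<Rightarrow> nat) \<Rightarrow> (real ^ 'd) \<times> (real ^ 'd)" where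
  "suff_stat T w y0 y = (mat_app T w y, mat_app T w (lag y0 y))"

definition logit_prob ::
  "nat \<Rightarrow> (nat \<Rightarrow> real ^ 'd) \<Rightarrow> nat \<Rightarrow> real \<Rightarrow> real ^ 'd \<Rightarrow> (nat \<Rightarrow> nat) \<Rightarrow> real" where
  "logit_prob T w y0 \<gamma> a y =
     (\<Prod>t = 1..T.
        (1 / (1 + exp (real (lag y0 y t) * \<gamma> + w t \<bullet> a))) ^ (1 - y t) *
        (exp (real (lag y0 y t) * \<gamma> + w t \<bullet> a) /
           (1 + exp (real (lag y0 y t) * \<gamma> + w t \<bullet> a))) ^ (y t))"

text \<open>The probabilities \<open>Pr(Y = y | X)\<close> are those of the kernel \<open>p\<close>: conditioning is on the
  sigma-algebra generated by \<open>X\<close>, so the equality is almost sure.\<close>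

definition has_cond_law ::
  "'a measure \<Rightarrow> nat \<Rightarrow> ('a \<Rightarrow> nat \<Rightarrow> nat) \<Rightarrow> ('a \<Rightarrow> 'x::topological_space) \<Rightarrow>
     ('x \<Rightarrow> (nat \<Rightarrow> nat) \<Rightarrow> real) \<Rightarrow> bool" where
  "has_cond_law M T Y X p \<longleftrightarrow>
     (\<forall>y \<in> outcomes T. AE \<omega> in M.
        real_cond_exp M (vimage_algebra (space M) X borel)
          (indicator {\<omega> \<in> space M. Y \<omega> = y}) \<omega> = p (X \<omega>) y)"

text \<open>\<open>M\<close> plays the role of the probability measure conditional on \<open>Y\<^sub>0 = y0\<close>; in particular
  the law of \<open>A\<close> under \<open>M\<close>, which is left unrestricted, is the distribution of \<open>A\<close> given
  \<open>Y\<^sub>0 = y0\<close>.\<close>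

definition ar_logit_model ::
  "nat \<Rightarrow> (nat \<Rightarrow> real ^ 'd) \<Rightarrow> nat \<Rightarrow> real \<Rightarrow> 'a measure \<Rightarrow>
     ('a \<Rightarrow> nat \<Rightarrow> nat) \<Rightarrow> ('a \<Rightarrow> real ^ 'd) \<Rightarrow> bool" where
  "ar_logit_model T w y0 \<gamma> M Y A \<longleftrightarrow>
     prob_space M \<and>
     Y \<in> measurable M (count_space (outcomes T)) \<and>
     A \<in> borel_measurable M \<and>
     has_cond_law M T Y A (logit_prob T w y0 \<gamma>)"

end

theory Submission
  imports Defs
begin

text \<open>Since every \<open>w\<^sub>t\<close> is a unit vector and the lagged outcomes are binary, the log-denominator
  \<open>ln (1 + exp (y\<^sub>t\<^sub>-\<^sub>1 \<gamma> + w\<^sub>t \<bullet> a))\<close> is affine in \<open>y\<^sub>t\<^sub>-\<^sub>1\<close> with a slope linear in \<open>w\<^sub>t\<close>, so the sum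
  over \<open>t\<close> sees \<open>y\<close> only through \<open>W Y\<^sub>l\<^sub>a\<^sub>g\<close>. Hence the likelihood is \<open>exp (\<gamma> N(y))\<close>, where \<open>N(y)\<close> is
  \<open>\<Sum>\<^sub>t y\<^sub>t y\<^sub>t\<^sub>-\<^sub>1\<close>, times a positive factor depending on \<open>y\<close> only through the sufficient statistic.
  Given the statistic, the law of \<open>Y\<close> is thus proportional to \<open>exp (\<gamma> N(y))\<close>. For two outcomes with
  the same statistic the factor integrates to the same number against any law of \<open>A\<close>, so the ratio
  of their probabilities is \<open>exp (\<gamma> (N(y) - N(y')))\<close>, which determines \<open>\<gamma>\<close>.\<close>


section \<open>Binary paths and unit vectors\<close>

lemma finite_outcomes [simp]: "finite (outcomes T)"
  unfolding outcomes_def by (intro finite_PiE) auto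

lemma lag_in_01:
  assumes "y \<in> outcomes T" "y0 \<in> {0, 1}" "t \<in> {1..T}"
  shows "lag y0 y t \<in> {0, 1}"
proof (cases "t = 1")
  case True
  then show ?thesis using assms by (simp add: lag_def)
next
  case False
  with assms(3) have "t - 1 \<in> {1..T}" by auto
  then have "y (t - 1) \<in> {0, 1}"
    using assms(1) unfolding outcomes_def by (rule PiE_mem[rotated])
  then show ?thesis using False assms(3) by (simp add: lag_def)
qed

text \<open>A sum of 0/1 entries counts the ones, so a total of 1 leaves a single nonzero
  coordinate. This is what makes \<open>w t \<bullet> a\<close> one coordinate of
  \<open>a\<close>.\<close>

lemma one_hot_eq_axis:
  fixes v :: "real ^ 'd"
  assumes "\<forall>k. v $ k \<in> {0, 1}" "(\<Sum>k\<in>UNIV. v $ k) = 1"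
  obtains k where "v = axis k 1"
proof -
  have "(\<Sum>k\<in>UNIV. v $ k) = (\<Sum>k\<in>UNIV. if v $ k = 1 then 1 else 0)"
    using assms(1) by (intro sum.cong) auto
  also have "\<dots> = real (card {k. v $ k = 1})"
    by (simp add: sum.If_cases)
  finally have "card {k. v $ k = 1} = 1" using assms(2) by simp
  then obtain k where k: "{k. v $ k = 1} = {k}" by (auto simp: card_1_singleton_iff)
  have "v = axis k 1"
  proof (unfold vec_eq_iff, intro allI)
    fix i
    show "v $ i = axis k 1 $ i"
      using k assms(1)[rule_format, of i] by (auto simp: axis_def)
  qed
  then show thesis by (rule that)
qed

section \<open>Equivalence of the two forms of the statistic\<close>

lemma V_mat_nth:
  "mat_app T (V_mat T w) y $ Inl k = mat_app T w y $ k"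
  "mat_app T (V_mat T w) y $ Inr k = mat_app T (W_lead T w) y $ k"
  by (simp_all add: mat_app_def V_mat_def)

text \<open>Shifting the index moves the lag from the outcome to the column:
  \<open>y (t - 1)\<close> paired with \<open>w t\<close> becomes \<open>y t\<close> paired with
  \<open>w (t + 1)\<close>. The first term survives as a constant known from \<open>y0\<close>, and
  \<open>y T\<close>, which is never a lag, meets the zero last column of
  \<open>W_lead\<close>.\<close>

lemma mat_app_lag:
  assumes "T \<ge> 1"
  shows "mat_app T w (lag y0 y) = real y0 *\<^sub>R w 1 + mat_app T (W_lead T w) y"
proof -
  obtain n where n: "T = Suc n" using assms by (cases T) auto
  have "mat_app T w (lag y0 y) = real y0 *\<^sub>R w 1 + (\<Sum>t = 1..n. real (y t) *\<^sub>R w (Suc t))"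
  proof -
    have "(\<Sum>t = 1..Suc n. real (lag y0 y t) *\<^sub>R w t)
        = real (lag y0 y 1) *\<^sub>R w 1 + (\<Sum>t = Suc 1..Suc n. real (lag y0 y t) *\<^sub>R w t)"
      by (rule sum.atLeast_Suc_atMost) simp
    also have "(\<Sum>t = Suc 1..Suc n. real (lag y0 y t) *\<^sub>R w t)
        = (\<Sum>t = 1..n. real (lag y0 y (Suc t)) *\<^sub>R w (Suc t))"
      by (rule sum.shift_bounds_cl_Suc_ivl)
    also have "\<dots> = (\<Sum>t = 1..n. real (y t) *\<^sub>R w (Suc t))"
      by (intro sum.cong) (auto simp: lag_def)
    finally show ?thesis by (simp add: mat_app_def n lag_def)
  qed
  moreover have "mat_app T (W_lead T w) y = (\<Sum>t = 1..n. real (y t) *\<^sub>R w (Suc t))"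
  proof -
    have "mat_app T (W_lead T w) y = (\<Sum>t = 1..n. real (y t) *\<^sub>R W_lead T w t)"
      by (simp add: mat_app_def n W_lead_def)
    also have "\<dots> = (\<Sum>t = 1..n. real (y t) *\<^sub>R w (Suc t))"
      by (intro sum.cong) (auto simp: W_lead_def n)
    finally show ?thesis .
  qed
  ultimately show ?thesis by simp
qed

text \<open>The lower block of the stacked vector differs from the lagged component of the statistic
  only by the known shift \<open>real y0 *\<^sub>R w 1\<close>; one map subtracts it, the other adds
  it back.\<close>

lemma V_mat_suff_stat_equiv:
  assumes "T \<ge> 1"
  shows "\<exists>f g. \<forall>y \<in> outcomes T.
          mat_app T (V_mat T w) y = f (suff_stat T w y0 y) \<and>
          suff_stat T w y0 y = g (mat_app T (V_mat T w) y)"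
proof (intro exI ballI conjI)
  fix y
  show "mat_app T (V_mat T w) y =
      (\<lambda>s. \<chi> i. case i of Inl k \<Rightarrow> fst s $ k | Inr k \<Rightarrow> (snd s - real y0 *\<^sub>R w 1) $ k)
        (suff_stat T w y0 y)"
    by (simp add: vec_eq_iff suff_stat_def mat_app_lag[OF assms] V_mat_nth split: sum.split)
  show "suff_stat T w y0 y =
      (\<lambda>v. ((\<chi> k. v $ Inl k), (\<chi> k. v $ Inr k) + real y0 *\<^sub>R w 1)) (mat_app T (V_mat T w) y)"
    by (simp add: vec_eq_iff suff_stat_def mat_app_lag[OF assms] V_mat_nth)
qed

section \<open>Factorization of the likelihood\<close>

definition transition_count :: "nat \<Rightarrow> nat \<Rightarrow> (nat \<Rightarrow> nat) \<Rightarrow> nat" where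
  "transition_count T y0 y = (\<Sum>t = 1..T. y t * lag y0 y t)"

text \<open>The subtracted sum collects the log-denominators at lag 0. The vector paired with
  \<open>snd s\<close> holds, coordinate by coordinate, their increments when the lag passes from 0
  to 1. Taking \<open>s\<close> instead of the path as argument makes it immediate that paths with
  equal statistic share this factor.\<close>

definition suff_factor ::
  "nat \<Rightarrow> (nat \<Rightarrow> real ^ 'd) \<Rightarrow> real \<Rightarrow> (real ^ 'd) \<times> (real ^ 'd) \<Rightarrow> real ^ 'd \<Rightarrow> real" where
  "suff_factor T w \<gamma> s a =
     exp (fst s \<bullet> a - (\<Sum>t = 1..T. ln (1 + exp (w t \<bullet> a)))
          - snd s \<bullet> (\<chi> k. ln (1 + exp (\<gamma> + a $ k)) - ln (1 + exp (a $ k))))"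

lemma logit_prob_factorization:
  fixes w :: "nat \<Rightarrow> real ^ 'd"
  assumes y0: "y0 \<in> {0, 1}"
    and w: "\<forall>t \<in> {1..T}. (\<forall>k. w t $ k \<in> {0, 1}) \<and> (\<Sum>k\<in>UNIV. w t $ k) = 1"
    and y: "y \<in> outcomes T"
  shows "logit_prob T w y0 \<gamma> a y =
    exp (\<gamma> * real (transition_count T y0 y)) * suff_factor T w \<gamma> (suff_stat T w y0 y) a"
proof -
  define l where "l t = real (lag y0 y t)" for t
  define \<psi> where "\<psi> x = ln (1 + exp (\<gamma> + x)) - ln (1 + exp x)" for x :: real
  have pos: "1 + exp x \<noteq> 0" "0 < 1 + exp x" for x :: real
    by (auto intro: add_pos_pos simp: add_nonneg_eq_0_iff)
  have factor: "(1 / (1 + exp (l t * \<gamma> + w t \<bullet> a))) ^ (1 - y t) *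
        (exp (l t * \<gamma> + w t \<bullet> a) / (1 + exp (l t * \<gamma> + w t \<bullet> a))) ^ (y t)
      = exp (real (y t) * (l t * \<gamma> + w t \<bullet> a) - ln (1 + exp (w t \<bullet> a))
          - l t * (w t \<bullet> (\<chi> k. \<psi> (a $ k))))" (is "?lhs = _") if t: "t \<in> {1..T}" for t
  proof -
    let ?x = "l t * \<gamma> + w t \<bullet> a"
    have "y t \<in> {0, 1}" using y t unfolding outcomes_def by (rule PiE_mem)
    then have "?lhs = exp (real (y t) * ?x) / (1 + exp ?x)" by auto
    also have "\<dots> = exp (real (y t) * ?x - ln (1 + exp ?x))"
      by (simp add: exp_diff pos)
    \<comment> \<open>Since \<open>w t\<close> selects one coordinate,
      \<open>w t \<bullet> (\<chi> k. \<psi> (a $ k))\<close> equals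
      \<open>\<psi> (w t \<bullet> a)\<close>. As the lag is 0 or 1, scaling this increment by the
      lag is exact.\<close>
    also have "ln (1 + exp ?x) = ln (1 + exp (w t \<bullet> a)) + l t * (w t \<bullet> (\<chi> k. \<psi> (a $ k)))"
    proof -
      obtain k where "w t = axis k 1" using w t one_hot_eq_axis by metis
      moreover have "l t = 0 \<or> l t = 1" using lag_in_01[OF y y0 t] by (auto simp: l_def)
      ultimately show ?thesis by (auto simp: inner_axis' \<psi>_def)
    qed
    finally show ?thesis by (simp add: algebra_simps)
  qed
  have "logit_prob T w y0 \<gamma> a y = exp (\<Sum>t = 1..T. real (y t) * (l t * \<gamma> + w t \<bullet> a)
      - ln (1 + exp (w t \<bullet> a)) - l t * (w t \<bullet> (\<chi> k. \<psi> (a $ k))))"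
    unfolding logit_prob_def exp_sum[OF finite_atLeastAtMost]
    by (intro prod.cong refl) (metis factor l_def)
  also have "(\<Sum>t = 1..T. real (y t) * (l t * \<gamma> + w t \<bullet> a)
      - ln (1 + exp (w t \<bullet> a)) - l t * (w t \<bullet> (\<chi> k. \<psi> (a $ k))))
      = \<gamma> * real (transition_count T y0 y) + (mat_app T w y \<bullet> a
        - (\<Sum>t = 1..T. ln (1 + exp (w t \<bullet> a))) - mat_app T w (lag y0 y) \<bullet> (\<chi> k. \<psi> (a $ k)))"
    by (simp add: transition_count_def mat_app_def l_def inner_sum_left sum_subtractf sum.distrib
        sum_distrib_left distrib_left algebra_simps)
  finally show ?thesis by (simp add: suff_factor_def suff_stat_def \<psi>_def exp_add)
qed

section \<open>Conditional laws as integral identities\<close>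

lemma logit_prob_bounds: "0 \<le> logit_prob T w y0 \<gamma> a y" "logit_prob T w y0 \<gamma> a y \<le> 1"
proof -
  have "0 \<le> 1 / (1 + exp x) \<and> 1 / (1 + exp x) \<le> 1 \<and> 0 \<le> exp x / (1 + exp x) \<and> exp x / (1 + exp x) \<le> 1"
    for x :: real using add_pos_pos[OF zero_less_one exp_gt_zero, of x] by (simp add: divide_simps)
  then show "0 \<le> logit_prob T w y0 \<gamma> a y" "logit_prob T w y0 \<gamma> a y \<le> 1"
    unfolding logit_prob_def
    by (auto intro!: prod_nonneg prod_le_1 mult_nonneg_nonneg mult_le_one zero_le_power power_le_one)
qed

lemma logit_prob_measurable [measurable]:
  "(\<lambda>a. logit_prob T w y0 \<gamma> a y) \<in> borel_measurable borel"
  unfolding logit_prob_def by measurable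

text \<open>Every event of the sigma-algebra generated by \<open>X\<close> is the preimage of some
  Borel set \<open>C\<close>, and integrals over these events determine the conditional expectation
  up to null sets. Almost sure statements thus become equations between numbers.\<close>

lemma has_cond_law_iff:
  fixes X :: "'a \<Rightarrow> 'x::topological_space"
  assumes "prob_space M"
    and Y: "Y \<in> measurable M (count_space (outcomes T))"
    and X: "X \<in> borel_measurable M"
    and p: "\<And>y. y \<in> outcomes T \<Longrightarrow> (\<lambda>x. p x y) \<in> borel_measurable borel"
    and int: "\<And>y. y \<in> outcomes T \<Longrightarrow> integrable M (\<lambda>\<omega>. p (X \<omega>) y)"
  shows "has_cond_law M T Y X p \<longleftrightarrow>
    (\<forall>y \<in> outcomes T. \<forall>C \<in> sets borel.
       measure M {\<omega> \<in> space M. Y \<omega> = y \<and> X \<omega> \<in> C} = (\<integral>\<omega>. indicator C (X \<omega>) * p (X \<omega>) y \<partial>M))"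
proof -
  interpret prob_space M by fact
  define F where "F = vimage_algebra (space M) X borel"
  have "subalgebra M F"
    using X unfolding F_def subalgebra_def
    by (auto simp: sets_vimage_algebra2 intro: measurable_sets)
  then interpret finite_measure_subalgebra M F
    by unfold_locales
  have XF: "X \<in> F \<rightarrow>\<^sub>M borel"
    unfolding F_def by (rule measurable_vimage_algebra1) simp
  have "(AE \<omega> in M. real_cond_exp M F (indicator {\<omega> \<in> space M. Y \<omega> = y}) \<omega> = p (X \<omega>) y) \<longleftrightarrow>
    (\<forall>C \<in> sets borel.
       measure M {\<omega> \<in> space M. Y \<omega> = y \<and> X \<omega> \<in> C} = (\<integral>\<omega>. indicator C (X \<omega>) * p (X \<omega>) y \<partial>M))"
    (is "?ae \<longleftrightarrow> ?int") if y: "y \<in> outcomes T" for y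
  proof -
    let ?I = "indicator {\<omega> \<in> space M. Y \<omega> = y} :: 'a \<Rightarrow> real"
    have Ysets: "{\<omega> \<in> space M. Y \<omega> = y} \<in> sets M"
      using measurable_sets[OF Y, of "{y}"] y by (simp add: vimage_def Int_def conj_commute)
    have intI: "integrable M ?I" using Ysets by (simp add: emeasure_eq_measure)
    note [measurable] = X p[OF y]
    have preimage: "(\<integral>\<omega>\<in>X -` C \<inter> space M. ?I \<omega> \<partial>M) = measure M {\<omega> \<in> space M. Y \<omega> = y \<and> X \<omega> \<in> C}"
      "(\<integral>\<omega>\<in>X -` C \<inter> space M. p (X \<omega>) y \<partial>M) = (\<integral>\<omega>. indicator C (X \<omega>) * p (X \<omega>) y \<partial>M)"
      if "C \<in> sets borel" for C
    proof -
      have "(\<integral>\<omega>\<in>X -` C \<inter> space M. ?I \<omega> \<partial>M)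
          = (\<integral>\<omega>. indicator {\<omega> \<in> space M. Y \<omega> = y \<and> X \<omega> \<in> C} \<omega> \<partial>M)"
        unfolding set_lebesgue_integral_def
        by (intro Bochner_Integration.integral_cong) (auto simp: indicator_def)
      also have "\<dots> = measure M {\<omega> \<in> space M. Y \<omega> = y \<and> X \<omega> \<in> C}"
        by (simp add: Int_def conj_commute conj_left_commute)
      finally show "(\<integral>\<omega>\<in>X -` C \<inter> space M. ?I \<omega> \<partial>M) = measure M {\<omega> \<in> space M. Y \<omega> = y \<and> X \<omega> \<in> C}" .
      show "(\<integral>\<omega>\<in>X -` C \<inter> space M. p (X \<omega>) y \<partial>M) = (\<integral>\<omega>. indicator C (X \<omega>) * p (X \<omega>) y \<partial>M)"
        unfolding set_lebesgue_integral_def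
        by (intro Bochner_Integration.integral_cong) (auto simp: indicator_def)
    qed
    show ?thesis
    proof
      assume ae: ?ae
      show ?int
      proof
        fix C :: "'x set" assume C: "C \<in> sets borel"
        then have CF: "X -` C \<inter> space M \<in> sets F"
          using measurable_sets[OF XF C] by (simp add: F_def)
        have "(\<integral>\<omega>\<in>X -` C \<inter> space M. ?I \<omega> \<partial>M)
            = (\<integral>\<omega>\<in>X -` C \<inter> space M. real_cond_exp M F ?I \<omega> \<partial>M)"
          by (rule real_cond_exp_intA[OF intI CF])
        also have "\<dots> = (\<integral>\<omega>\<in>X -` C \<inter> space M. p (X \<omega>) y \<partial>M)"
          unfolding set_lebesgue_integral_def
          by (rule integral_cong_AE) (use ae C in auto)
        finally show "measure M {\<omega> \<in> space M. Y \<omega> = y \<and> X \<omega> \<in> C}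
            = (\<integral>\<omega>. indicator C (X \<omega>) * p (X \<omega>) y \<partial>M)"
          by (simp add: preimage[OF C])
      qed
    next
      assume int': ?int
      \<comment> \<open>Uniqueness of conditional expectation: the candidate is a Borel function of
        \<open>X\<close>, hence measurable for \<open>F\<close>, and its integral over each event of
        \<open>F\<close> is the right one.\<close>
      show ?ae
      proof (rule real_cond_exp_charact)
        fix B assume "B \<in> sets F"
        then obtain C where C: "C \<in> sets borel" "B = X -` C \<inter> space M"
          by (auto simp: F_def sets_vimage_algebra2)
        then show "(\<integral>\<omega>\<in>B. ?I \<omega> \<partial>M) = (\<integral>\<omega>\<in>B. p (X \<omega>) y \<partial>M)"
          using int' by (simp add: preimage[OF C(1)])
      next
        show "(\<lambda>\<omega>. p (X \<omega>) y) \<in> borel_measurable F"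
          using XF by measurable
      qed (use intI int[OF y] in auto)
    qed
  qed
  then show ?thesis unfolding has_cond_law_def F_def by blast
qed

text \<open>The case \<open>X = A\<close> of the characterisation: the likelihood lies between 0 and
  1, so it is integrable whatever the law of \<open>A\<close>.\<close>

lemma ar_logit_model_joint_prob:
  fixes A :: "'a \<Rightarrow> real ^ 'd"
  assumes "ar_logit_model T w y0 \<gamma> M Y A" "y \<in> outcomes T" "C \<in> sets borel"
  shows "measure M {\<omega> \<in> space M. Y \<omega> = y \<and> A \<omega> \<in> C} =
    (\<integral>\<omega>. indicator C (A \<omega>) * logit_prob T w y0 \<gamma> (A \<omega>) y \<partial>M)"
proof -
  have "prob_space M" and Y: "Y \<in> measurable M (count_space (outcomes T))"
    and A [measurable]: "A \<in> borel_measurable M"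
    and law: "has_cond_law M T Y A (logit_prob T w y0 \<gamma>)"
    using assms(1) by (auto simp: ar_logit_model_def)
  then interpret prob_space M by simp
  have "integrable M (\<lambda>\<omega>. logit_prob T w y0 \<gamma> (A \<omega>) z)" for z
    by (rule integrable_const_bound[where B = 1])
      (auto simp: logit_prob_bounds abs_le_iff intro!: order_trans[OF _ logit_prob_bounds(1)])
  with has_cond_law_iff[OF \<open>prob_space M\<close> Y A] law assms show ?thesis by simp
qed

section \<open>Sufficiency: the conditional law given the statistic\<close>

lemma exists_normalized_pmf:
  fixes f :: "'b \<Rightarrow> real"
  assumes "finite B" "B \<noteq> {}" "\<And>y. y \<in> B \<Longrightarrow> f y > 0"
  obtains q where "\<And>y. pmf q y = (if y \<in> B then f y / sum f B else 0)"
proof -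
  have pos: "sum f B > 0" using assms by (simp add: sum_pos)
  let ?g = "\<lambda>y. if y \<in> B then f y / sum f B else 0"
  have nn: "?g y \<ge> 0" for y
    using assms(3)[of y] pos by (simp add: less_imp_le)
  have "(\<integral>\<^sup>+ y. ennreal (?g y) \<partial>count_space UNIV) = (\<Sum>y\<in>B. ennreal (?g y))"
    using assms(1) by (intro nn_integral_count_space') auto
  also have "\<dots> = ennreal (\<Sum>y\<in>B. ?g y)" by (intro sum_ennreal nn)
  also have "(\<Sum>y\<in>B. ?g y) = 1" using pos by (simp flip: sum_divide_distrib)
  finally have "(\<integral>\<^sup>+ y. ennreal (?g y) \<partial>count_space UNIV) = 1" by simp
  then have "pmf (embed_pmf ?g) y = ?g y" for y by (rule pmf_embed_pmf[OF nn])
  then show thesis by (rule that)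
qed

text \<open>On each nonempty fibre of the statistic the positive weights
  \<open>exp (\<gamma> * N)\<close>, with \<open>N\<close> the transition count, are normalized. The
  kernel must also be a pmf at values \<open>s\<close> that no outcome attains.\<close>

lemma exists_cond_pmf:
  assumes "T \<ge> 1"
  shows "\<exists>q :: (real ^ 'd) \<times> (real ^ 'd) \<Rightarrow> (nat \<Rightarrow> nat) pmf.
    \<forall>s. \<forall>y \<in> outcomes T. pmf (q s) y =
      (if suff_stat T w y0 y = s
       then exp (\<gamma> * real (transition_count T y0 y)) /
         (\<Sum>z \<in> {z \<in> outcomes T. suff_stat T w y0 z = s}. exp (\<gamma> * real (transition_count T y0 z)))
       else 0)"
proof -
  define f where "f y = exp (\<gamma> * real (transition_count T y0 y))" for y
  define B where "B s = {z \<in> outcomes T. suff_stat T w y0 z = s}" for s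
  have "\<exists>r. \<forall>y \<in> outcomes T. pmf r y = (if suff_stat T w y0 y = s then f y / sum f (B s) else 0)"
    for s
  proof (cases "B s = {}")
    case True
    \<comment> \<open>For an unattained \<open>s\<close>, a point mass outside the outcomes serves
      as default; position 1 exists because \<open>T \<ge> 1\<close>, and the value 2 there is not
      binary.\<close>
    have "(\<lambda>_. 2) \<notin> outcomes T" using assms by (auto simp: outcomes_def dest: PiE_mem[of _ _ _ 1])
    then have "pmf (return_pmf (\<lambda>_. 2)) y = 0" if "y \<in> outcomes T" for y
      using that by (auto simp: indicator_def)
    with True show ?thesis by (intro exI[of _ "return_pmf (\<lambda>_. 2)"]) (auto simp: B_def)
  next
    case False
    have "finite (B s)" by (simp add: B_def)
    from exists_normalized_pmf[OF this False, of f] obtain r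
      where "\<And>y. pmf r y = (if y \<in> B s then f y / sum f (B s) else 0)" by (auto simp: f_def)
    then show ?thesis by (intro exI[of _ r]) (auto simp: B_def)
  qed
  then have "\<exists>q. \<forall>s. \<forall>y \<in> outcomes T.
      pmf (q s) y = (if suff_stat T w y0 y = s then f y / sum f (B s) else 0)"
    by (intro choice allI)
  then show ?thesis unfolding f_def B_def .
qed

text \<open>Sufficiency is expressed by conditioning on the pair of statistic and \<open>A\<close>
  with a kernel that discards \<open>a\<close>, and by choosing \<open>q\<close> before
  \<open>M\<close>, \<open>Y\<close> and \<open>A\<close>, so that one kernel serves every law of
  \<open>A\<close>.\<close>

lemma suff_stat_sufficient:
  fixes w :: "nat \<Rightarrow> real ^ 'd"
  assumes T: "T \<ge> 1" and y0: "y0 \<in> {0, 1}"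
    and w: "\<forall>t \<in> {1..T}. (\<forall>k. w t $ k \<in> {0, 1}) \<and> (\<Sum>k\<in>UNIV. w t $ k) = 1"
  shows "\<exists>q :: (real ^ 'd) \<times> (real ^ 'd) \<Rightarrow> (nat \<Rightarrow> nat) pmf.
    \<forall>(M :: 'a measure) Y A. ar_logit_model T w y0 \<gamma> M Y A \<longrightarrow>
      has_cond_law M T Y (\<lambda>\<omega>. (suff_stat T w y0 (Y \<omega>), A \<omega>)) (\<lambda>(s, a). pmf (q s))"
proof -
  let ?S = "suff_stat T w y0"
  define f where "f y = exp (\<gamma> * real (transition_count T y0 y))" for y
  define B where "B s = {z \<in> outcomes T. ?S z = s}" for s
  obtain q :: "(real ^ 'd) \<times> (real ^ 'd) \<Rightarrow> (nat \<Rightarrow> nat) pmf" where q: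
    "\<And>s y. y \<in> outcomes T \<Longrightarrow> pmf (q s) y = (if ?S y = s then f y / sum f (B s) else 0)"
    unfolding f_def B_def using exists_cond_pmf[OF T, of w y0 \<gamma>] by blast
  have "has_cond_law M T Y (\<lambda>\<omega>. (?S (Y \<omega>), A \<omega>)) (\<lambda>(s, a). pmf (q s))"
    if model: "ar_logit_model T w y0 \<gamma> M Y A" for M :: "'a measure" and Y A
  proof -
    have "prob_space M" and Y [measurable]: "Y \<in> measurable M (count_space (outcomes T))"
      and A [measurable]: "A \<in> borel_measurable M"
      using model by (auto simp: ar_logit_model_def)
    then interpret prob_space M by simp
    have YS: "(\<lambda>\<omega>. ?S (Y \<omega>)) \<in> borel_measurable M"
      by (rule measurable_compose[OF Y]) simp
    have X: "(\<lambda>\<omega>. (?S (Y \<omega>), A \<omega>)) \<in> borel_measurable M"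
      using YS A by (rule borel_measurable_Pair)
    have qm: "(\<lambda>s. pmf (q s) y) \<in> borel_measurable borel" if "y \<in> outcomes T" for y
    proof -
      \<comment> \<open>For fixed \<open>y\<close>, only the single value \<open>?S y\<close> of
        \<open>s\<close> receives positive mass, so this is a multiple of the indicator of a
        point.\<close>
      have "(\<lambda>s. pmf (q s) y) = (\<lambda>s. indicator {?S y} s * (f y / sum f (B (?S y))))"
        using q[OF that] by (auto simp: fun_eq_iff indicator_def)
      then show ?thesis by simp
    qed
    have pm: "(\<lambda>x. (case x of (s, a :: real ^ 'd) \<Rightarrow> pmf (q s)) y) \<in> borel_measurable borel"
      if "y \<in> outcomes T" for y
    proof -
      have "(\<lambda>x :: ((real ^ 'd) \<times> (real ^ 'd)) \<times> (real ^ 'd). pmf (q (fst x)) y) \<in> borel_measurable borel"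
        by (rule measurable_compose[OF borel_measurable_continuous_onI qm[OF that]])
          (intro continuous_intros)
      then show ?thesis by (simp add: case_prod_beta')
    qed
    have intp: "integrable M (\<lambda>\<omega>. (case (?S (Y \<omega>), A \<omega>) of (s, a) \<Rightarrow> pmf (q s)) y)"
      if "y \<in> outcomes T" for y
      using measurable_compose[OF YS qm[OF that]]
      by (intro integrable_const_bound[where B = 1]) (auto simp: pmf_le_1)
    have "prob {\<omega> \<in> space M. Y \<omega> = y \<and> (?S (Y \<omega>), A \<omega>) \<in> C} =
        (\<integral>\<omega>. indicator C (?S (Y \<omega>), A \<omega>) * (case (?S (Y \<omega>), A \<omega>) of (s, a) \<Rightarrow> pmf (q s)) y \<partial>M)"
      if y: "y \<in> outcomes T" and C: "C \<in> sets borel" for y C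
    proof -
      define s where "s = ?S y"
      \<comment> \<open>Only the section of \<open>C\<close> at \<open>s\<close> matters: the kernel
        gives \<open>y\<close> no mass at other values of the statistic.\<close>
      define D where "D = {a. (s, a) \<in> C}"
      have D: "D \<in> sets borel"
      proof -
        have "Pair s -` C \<inter> space borel \<in> sets borel"
          by (rule measurable_sets[OF _ C]) (intro borel_measurable_Pair; simp)
        then show ?thesis by (simp add: D_def vimage_def)
      qed
      have yB: "y \<in> B s" using y by (simp add: B_def s_def)
      have fin: "finite (B s)" by (simp add: B_def)
      have sumpos: "sum f (B s) > 0"
        using yB fin by (intro sum_pos) (auto simp: f_def)
      let ?E = "\<lambda>z. {\<omega> \<in> space M. Y \<omega> = z \<and> A \<omega> \<in> D}"
      let ?h = "\<lambda>\<omega>. indicator D (A \<omega>) * suff_factor T w \<gamma> s (A \<omega>)"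
      \<comment> \<open>The key point: the integral is the same for all \<open>z\<close> in the
        fibre, so the joint probabilities are proportional to \<open>f z\<close>.\<close>
      have joint: "prob (?E z) = f z * (\<integral>\<omega>. ?h \<omega> \<partial>M)" if z: "z \<in> B s" for z
      proof -
        have "prob (?E z) = (\<integral>\<omega>. f z * ?h \<omega> \<partial>M)"
          using ar_logit_model_joint_prob[OF model _ D, of z] z
          by (simp add: B_def logit_prob_factorization[OF y0 w] f_def mult_ac)
        then show ?thesis by simp
      qed
      have E: "?E z \<in> events" if "z \<in> outcomes T" for z
      proof -
        have "?E z = (Y -` {z} \<inter> space M) \<inter> (A -` D \<inter> space M)" by auto
        then show ?thesis using measurable_sets[OF Y, of "{z}"] measurable_sets[OF A D] that by simp
      qed
      \<comment> \<open>The integrand vanishes off the fibre and is constant on each event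
        \<open>?E z\<close>, so it can be split according to the value of \<open>Y\<close>.\<close>
      have "indicator C (?S (Y \<omega>), A \<omega>) * (case (?S (Y \<omega>), A \<omega>) of (s, a) \<Rightarrow> pmf (q s)) y
          = (\<Sum>z \<in> B s. f y / sum f (B s) * indicator (?E z) \<omega>)" if \<omega>: "\<omega> \<in> space M" for \<omega>
      proof -
        have Y\<omega>: "Y \<omega> \<in> outcomes T" using measurable_space[OF Y \<omega>] by simp
        have "(\<Sum>z \<in> B s. f y / sum f (B s) * indicator (?E z) \<omega>)
            = (\<Sum>z \<in> B s. if z = Y \<omega> then f y / sum f (B s) * indicator D (A \<omega>) else 0)"
          using \<omega> by (intro sum.cong) (auto simp: indicator_def)
        also have "\<dots> = (if Y \<omega> \<in> B s then f y / sum f (B s) * indicator D (A \<omega>) else 0)"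
          using fin by simp
        also have "\<dots> = indicator C (?S (Y \<omega>), A \<omega>) * pmf (q (?S (Y \<omega>))) y"
          using Y\<omega> by (auto simp: q[OF y] B_def s_def D_def indicator_def)
        finally show ?thesis by simp
      qed
      then have "(\<integral>\<omega>. indicator C (?S (Y \<omega>), A \<omega>) * (case (?S (Y \<omega>), A \<omega>) of (s, a) \<Rightarrow> pmf (q s)) y \<partial>M)
          = (\<integral>\<omega>. (\<Sum>z \<in> B s. f y / sum f (B s) * indicator (?E z) \<omega>) \<partial>M)"
        by (intro Bochner_Integration.integral_cong) auto
      also have "\<dots> = (\<Sum>z \<in> B s. f y / sum f (B s) * prob (?E z))"
        using E by (subst Bochner_Integration.integral_sum)
          (auto simp: B_def emeasure_eq_measure Int_def conj_commute conj_left_commute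
            intro!: sum.cong integrable_mult_right)
      \<comment> \<open>Summing the joint probabilities over the fibre reproduces the normalizing
        constant, which then cancels.\<close>
      also have "\<dots> = f y / sum f (B s) * (sum f (B s) * (\<integral>\<omega>. ?h \<omega> \<partial>M))"
        unfolding sum_distrib_right sum_distrib_left by (intro sum.cong) (auto simp: joint)
      also have "\<dots> = prob (?E y)"
        using sumpos by (simp add: joint[OF yB])
      also have "?E y = {\<omega> \<in> space M. Y \<omega> = y \<and> (?S (Y \<omega>), A \<omega>) \<in> C}"
        by (auto simp: D_def s_def)
      finally show ?thesis by simp
    qed
    then show ?thesis
      by (subst has_cond_law_iff[OF \<open>prob_space M\<close> Y X pm intp]) auto
  qed
  then show ?thesis by blast
qed

section \<open>Identification of \<gamma>\<close>

lemma ar_logit_model_marginal_ratio: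
  fixes w :: "nat \<Rightarrow> real ^ 'd"
  assumes y0: "y0 \<in> {0, 1}"
    and w: "\<forall>t \<in> {1..T}. (\<forall>k. w t $ k \<in> {0, 1}) \<and> (\<Sum>k\<in>UNIV. w t $ k) = 1"
    and model: "ar_logit_model T w y0 \<gamma> M Y A"
    and y: "y \<in> outcomes T" and y': "y' \<in> outcomes T"
    and eq: "suff_stat T w y0 y = suff_stat T w y0 y'"
  defines "P \<equiv> measure (distr M (count_space (outcomes T)) Y)"
  shows "P {y} > 0"
    and "P {y} = exp (\<gamma> * (real (transition_count T y0 y) - real (transition_count T y0 y'))) * P {y'}"
proof -
  have "prob_space M" and Y: "Y \<in> measurable M (count_space (outcomes T))"
    and A [measurable]: "A \<in> borel_measurable M"
    using model by (auto simp: ar_logit_model_def)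
  then interpret prob_space M by simp
  have P: "P {z} = (\<integral>\<omega>. logit_prob T w y0 \<gamma> (A \<omega>) z \<partial>M)" if "z \<in> outcomes T" for z
  proof -
    have "P {z} = prob {\<omega> \<in> space M. Y \<omega> = z \<and> A \<omega> \<in> UNIV}"
      unfolding P_def using that
      by (simp add: measure_distr[OF Y] vimage_def Int_def conj_commute)
    then show ?thesis using ar_logit_model_joint_prob[OF model that, of UNIV] by simp
  qed
  have int: "integrable M (\<lambda>\<omega>. logit_prob T w y0 \<gamma> (A \<omega>) y)"
    by (rule integrable_const_bound[where B = 1])
      (auto simp: logit_prob_bounds abs_le_iff intro!: order_trans[OF _ logit_prob_bounds(1)])
  \<comment> \<open>The likelihood is a product of exponentials, so its integral against a
    probability measure is strictly positive, whatever the law of \<open>A\<close>.\<close>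
  have "0 < logit_prob T w y0 \<gamma> a y" for a
    by (simp add: logit_prob_factorization[OF y0 w y] suff_factor_def)
  then show "P {y} > 0"
    unfolding P[OF y] using int
    using integral_less_AE_space[of "\<lambda>_. 0" "\<lambda>\<omega>. logit_prob T w y0 \<gamma> (A \<omega>) y"]
    by (simp add: emeasure_space_1)
  \<comment> \<open>The common \<open>suff_factor\<close> drops out for every \<open>a\<close>, so
    the ratio survives integration over the unknown law.\<close>
  have "logit_prob T w y0 \<gamma> a y =
      exp (\<gamma> * (real (transition_count T y0 y) - real (transition_count T y0 y'))) * logit_prob T w y0 \<gamma> a y'" for a
    by (simp add: logit_prob_factorization[OF y0 w] y y' eq right_diff_distrib exp_diff)
  then show "P {y} = exp (\<gamma> * (real (transition_count T y0 y) - real (transition_count T y0 y'))) * P {y'}"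
    by (simp add: P y y')
qed

theorem theorem2:
  fixes T :: nat and w :: "nat \<Rightarrow> real ^ 'd" and y0 :: nat
  assumes "T \<ge> 1"
    and "y0 \<in> {0, 1}"
    and "\<forall>t \<in> {1..T}. (\<forall>k. w t $ k \<in> {0, 1}) \<and> (\<Sum>k\<in>UNIV. w t $ k) = 1"
  shows
    "(\<forall>\<gamma>. \<exists>q :: (real ^ 'd) \<times> (real ^ 'd) \<Rightarrow> (nat \<Rightarrow> nat) pmf.
        \<forall>(M :: 'a measure) Y A. ar_logit_model T w y0 \<gamma> M Y A \<longrightarrow>
          has_cond_law M T Y (\<lambda>\<omega>. (suff_stat T w y0 (Y \<omega>), A \<omega>)) (\<lambda>(s, a). pmf (q s)))
     \<and> (\<exists>f g. \<forall>y \<in> outcomes T.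
          mat_app T (V_mat T w) y = f (suff_stat T w y0 y) \<and>
          suff_stat T w y0 y = g (mat_app T (V_mat T w) y))
     \<and> ((\<exists>y \<in> outcomes T. \<exists>y' \<in> outcomes T.
            mat_app T (V_mat T w) y = mat_app T (V_mat T w) y' \<and>
            (\<Sum>t = 1..T. y t * lag y0 y t) \<noteq> (\<Sum>t = 1..T. y' t * lag y0 y' t)) \<longrightarrow>
        (\<forall>\<gamma> \<gamma>' (M :: 'b measure) Y A (M' :: 'c measure) Y' A'.
            ar_logit_model T w y0 \<gamma> M Y A \<and> ar_logit_model T w y0 \<gamma>' M' Y' A' \<and>
            distr M (count_space (outcomes T)) Y = distr M' (count_space (outcomes T)) Y' \<longrightarrow>
            \<gamma> = \<gamma>'))"
proof (intro conjI impI allI)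
  show "\<exists>q :: (real ^ 'd) \<times> (real ^ 'd) \<Rightarrow> (nat \<Rightarrow> nat) pmf.
        \<forall>(M :: 'a measure) Y A. ar_logit_model T w y0 \<gamma> M Y A \<longrightarrow>
          has_cond_law M T Y (\<lambda>\<omega>. (suff_stat T w y0 (Y \<omega>), A \<omega>)) (\<lambda>(s, a). pmf (q s))" for \<gamma>
    using assms by (rule suff_stat_sufficient)
  show VS: "\<exists>f g. \<forall>y \<in> outcomes T.
          mat_app T (V_mat T w) y = f (suff_stat T w y0 y) \<and>
          suff_stat T w y0 y = g (mat_app T (V_mat T w) y)"
    using assms(1) by (rule V_mat_suff_stat_equiv)
  fix \<gamma> \<gamma>' and M :: "'b measure" and Y A and M' :: "'c measure" and Y' A'
  assume "\<exists>y \<in> outcomes T. \<exists>y' \<in> outcomes T.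
            mat_app T (V_mat T w) y = mat_app T (V_mat T w) y' \<and>
            (\<Sum>t = 1..T. y t * lag y0 y t) \<noteq> (\<Sum>t = 1..T. y' t * lag y0 y' t)"
  then obtain y y' where y: "y \<in> outcomes T" "y' \<in> outcomes T"
      and V: "mat_app T (V_mat T w) y = mat_app T (V_mat T w) y'"
      and N: "transition_count T y0 y \<noteq> transition_count T y0 y'"
    by (auto simp: transition_count_def)
  assume "ar_logit_model T w y0 \<gamma> M Y A \<and> ar_logit_model T w y0 \<gamma>' M' Y' A' \<and>
            distr M (count_space (outcomes T)) Y = distr M' (count_space (outcomes T)) Y'"
  then have model: "ar_logit_model T w y0 \<gamma> M Y A"
    and model': "ar_logit_model T w y0 \<gamma>' M' Y' A'"
    and distr: "distr M (count_space (outcomes T)) Y = distr M' (count_space (outcomes T)) Y'"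
    by auto
  have S: "suff_stat T w y0 y = suff_stat T w y0 y'" using VS V y by metis
  note ratio = ar_logit_model_marginal_ratio[OF assms(2,3) model y S]
  \<comment> \<open>Folding with the equality of laws expresses both ratios through the same
    probabilities of \<open>y\<close> and \<open>y'\<close>.\<close>
  note ratio' = ar_logit_model_marginal_ratio(2)[OF assms(2,3) model' y S, folded distr]
  let ?d = "real (transition_count T y0 y) - real (transition_count T y0 y')"
  \<comment> \<open>Positivity of the probability of \<open>y\<close> forces that of
    \<open>y'\<close> to be nonzero, so it can be cancelled. Injectivity of \<open>exp\<close> and
    \<open>?d \<noteq> 0\<close> then give the claim.\<close>
  have "exp (\<gamma> * ?d) = exp (\<gamma>' * ?d)"
    using ratio ratio' by (metis less_irrefl mult_cancel_right mult_zero_right)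
  then show "\<gamma> = \<gamma>'" using N by simp
qed

end
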